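(* Let $k$ be a constant. For a BDL-tree containing $n$ points, $k$-nearest-neighbor queries for a batch of $B$ query points can be performed in $O(Bn)$ work and $O(n)$ depth.
   Context: A BDL-tree storing points in $\mathbb{R}^d$ consists of a buffer $k$d-tree and a collection of static $k$d-trees $T_0,T_1,\dots$ with capacities $2^iX$ for a constant $X$, whose sizes $n_i$ sum to $n$. A $k$-NN query for a point $q$ returns the $k$ stored points closest to $q$. The batch query is performed by allocating a $k$-NN buffer (holding the $k$ closest points found so far, amortized $O(1)$ insertion) per query point and, for each nonempty tree in turn, running a pruned $k$d-tree traversal for all query points in parallel (each query's traversal serial), sharing the buffers. Complexity is in the work-depth model: work is the total number of operations, depth is the length of the longest chain of sequential dependencies. *)

theory Defs
  imports "HOL-Analysis.Analysis" "HOL-Library.Multiset"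
begin

section \<open>Work-depth model\<close>

text \<open>
  A value of type \<^emph>\<open>'r comp\<close> is a computation with result, work (number of operations) and
  depth (length of the longest chain of dependent operations). Operations are charged by
  \<^emph>\<open>ticks\<close>; \<^emph>\<open>ret\<close> itself is free.
\<close>

datatype 'r comp = Comp (result: 'r) (work: nat) (depth: nat)

definition ret :: "'r \<Rightarrow> 'r comp" where
  "ret x = Comp x 0 0"

definition ticks :: "nat \<Rightarrow> unit comp" where
  "ticks c = Comp () c c"

definition seq :: "'a comp \<Rightarrow> ('a \<Rightarrow> 'b comp) \<Rightarrow> 'b comp" (infixl "\<triangleright>" 54) where
  "m \<triangleright> f = (let m' = f (result m) in
     Comp (result m') (work m + work m') (depth m + depth m'))"

lemma seq_cong [fundef_cong]:
  "m = m' \<Longrightarrow> (\<And>x. x = result m' \<Longrightarrow> f x = g x) \<Longrightarrow> m \<triangleright> f = m' \<triangleright> g"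
  by (simp add: seq_def)

text \<open>
  Parallel loop with arbitrary fan-out: every iteration costs one extra operation for being
  spawned, and spawning and joining all iterations adds one to the depth.
\<close>

definition par_map :: "('a \<Rightarrow> 'b comp) \<Rightarrow> 'a list \<Rightarrow> 'b list comp" where
  "par_map f xs = Comp (map (\<lambda>x. result (f x)) xs)
     (1 + (\<Sum>x\<leftarrow>xs. 1 + work (f x)))
     (1 + Max (insert 0 ((\<lambda>x. depth (f x)) ` set xs)))"

fun seq_fold :: "('s \<Rightarrow> 'a \<Rightarrow> 's comp) \<Rightarrow> 's \<Rightarrow> 'a list \<Rightarrow> 's comp" where
  "seq_fold f s [] = ret s"
| "seq_fold f s (x # xs) = ticks 1 \<triangleright> (\<lambda>_. f s x \<triangleright> (\<lambda>s'. seq_fold f s' xs))"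


section \<open>\<open>k\<close>d-trees and BDL-trees\<close>

text \<open>
  Points are stored in the leaves. Every node carries the lower and upper corner of a bounding box;
  an inner node also carries its splitting coordinate and splitting value.
\<close>

datatype ('d::finite) kd_tree =
  Leaf (box_lo: "real ^ 'd") (box_hi: "real ^ 'd") "(real ^ 'd) list"
| Node (box_lo: "real ^ 'd") (box_hi: "real ^ 'd") 'd real "'d kd_tree" "'d kd_tree"

fun points :: "('d::finite) kd_tree \<Rightarrow> (real ^ 'd) multiset" where
  "points (Leaf lo hi ps) = mset ps"
| "points (Node lo hi i s l r) = points l + points r"

text \<open>
  Neither balance, nor the median as splitting value, nor tightness of the boxes is required, so
  that trees from which points have been deleted are covered as well. Leaves are nonempty: subtrees
  without points are not stored.
\<close>

fun wf_kd_tree :: "('d::finite) kd_tree \<Rightarrow> bool" where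
  "wf_kd_tree (Leaf lo hi ps) \<longleftrightarrow> ps \<noteq> [] \<and> set ps \<subseteq> cbox lo hi"
| "wf_kd_tree (Node lo hi i s l r) \<longleftrightarrow>
     wf_kd_tree l \<and> wf_kd_tree r \<and>
     (\<forall>x\<in>#points l. x $ i \<le> s) \<and> (\<forall>x\<in>#points r. s \<le> x $ i) \<and>
     set_mset (points l + points r) \<subseteq> cbox lo hi"

text \<open>
  An empty buffer tree is \<^emph>\<open>None\<close>. The nonempty ones among the static trees \<open>T\<^sub>0, T\<^sub>1, \<dots>\<close>
  are listed with their indices; an index that is not listed stands for an empty tree.
\<close>

datatype ('d::finite) bdl_tree =
  BDL (buffer_tree: "'d kd_tree option") (static_trees: "(nat \<times> 'd kd_tree) list")

definition nonempty_trees :: "('d::finite) bdl_tree \<Rightarrow> 'd kd_tree list" where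
  "nonempty_trees T =
     (case buffer_tree T of None \<Rightarrow> [] | Some t \<Rightarrow> [t]) @ map snd (static_trees T)"

definition bdl_points :: "('d::finite) bdl_tree \<Rightarrow> (real ^ 'd) multiset" where
  "bdl_points T = (\<Sum>t\<leftarrow>nonempty_trees T. points t)"

definition wf_bdl_tree :: "nat \<Rightarrow> ('d::finite) bdl_tree \<Rightarrow> bool" where
  "wf_bdl_tree X T \<longleftrightarrow>
     (\<forall>t\<in>set (nonempty_trees T). wf_kd_tree t) \<and>
     (\<forall>t. buffer_tree T = Some t \<longrightarrow> size (points t) \<le> X) \<and>
     sorted_wrt (<) (map fst (static_trees T)) \<and>
     (\<forall>(i, t)\<in>set (static_trees T). size (points t) \<le> 2 ^ i * X)"


section \<open>Nearest neighbors\<close>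

text \<open>
  \<^emph>\<open>ys\<close> are the \<open>k\<close> points of the multiset \<^emph>\<open>S\<close> closest to \<^emph>\<open>q\<close> (all of \<^emph>\<open>S\<close> if there
  are fewer than \<open>k\<close>), in any order and with ties broken arbitrarily.
\<close>

definition is_knn :: "nat \<Rightarrow> ('a::metric_space) multiset \<Rightarrow> 'a \<Rightarrow> 'a list \<Rightarrow> bool" where
  "is_knn k S q ys \<longleftrightarrow>
     mset ys \<subseteq># S \<and> length ys = min k (size S) \<and>
     (\<forall>y\<in>set ys. \<forall>z\<in>#S - mset ys. dist q y \<le> dist q z)"

text \<open>Distances cost one operation per coordinate.\<close>

definition point_dist :: "real ^ 'd \<Rightarrow> real ^ 'd \<Rightarrow> real comp" where
  "point_dist q p = ticks CARD('d) \<triangleright> (\<lambda>_. ret (dist q p))"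

text \<open>The distance from \<^emph>\<open>q\<close> to a box is the distance to the point obtained by clamping \<^emph>\<open>q\<close>.\<close>

definition box_dist :: "real ^ 'd \<Rightarrow> real ^ 'd \<Rightarrow> real ^ 'd \<Rightarrow> real comp" where
  "box_dist q lo hi =
     ticks CARD('d) \<triangleright> (\<lambda>_. ret (dist q (\<chi> i. max (lo $ i) (min (q $ i) (hi $ i)))))"


subsection \<open>The \<open>k\<close>-NN buffer\<close>

text \<open>
  A buffer is an array with room for \<open>2 * k\<close> candidates, each stored with its distance to the query
  point. An insertion appends the new candidate; when the array gets full, a selection
  discards all but the \<open>k\<close> closest candidates. Lists represent arrays whose length is maintained, so
  appending an element and reading the length are single operations.
\<close>

type_synonym 'd knn_buffer = "(real \<times> (real ^ 'd)) list"

fun partition_dist ::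
    "real \<Rightarrow> ('d::finite) knn_buffer \<Rightarrow> ('d knn_buffer \<times> 'd knn_buffer) comp" where
  "partition_dist r [] = ret ([], [])"
| "partition_dist r (c # cs) = ticks 1 \<triangleright> (\<lambda>_. partition_dist r cs \<triangleright> (\<lambda>(lo, hi).
     ret (if fst c < r then (c # lo, hi) else (lo, c # hi))))"

lemma length_partition_dist:
  "length (fst (result (partition_dist r cs))) + length (snd (result (partition_dist r cs))) =
     length cs"
  by (induction cs) (auto simp: ret_def seq_def Let_def split: prod.splits)

text \<open>Quickselect with the first element as pivot; its cost is quadratic in the length at worst.\<close>

function select_closest :: "nat \<Rightarrow> ('d::finite) knn_buffer \<Rightarrow> 'd knn_buffer comp" where
  "select_closest k [] = ticks 1 \<triangleright> (\<lambda>_. ret [])"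
| "select_closest k (c # cs) = partition_dist (fst c) cs \<triangleright> (\<lambda>(lo, hi).
     ticks (1 + length lo) \<triangleright> (\<lambda>_.
       if k \<le> length lo then select_closest k lo
       else select_closest (k - length lo - 1) hi \<triangleright> (\<lambda>hi'. ret (lo @ c # hi'))))"
  by pat_completeness auto
termination
proof (relation "inv_image less_than (\<lambda>(k, cs). length cs)", goal_cases)
  case 1
  show ?case by simp
next
  case (2 k c cs x lo hi)
  then show ?case
    using length_partition_dist[of "fst c" cs] by (cases "result (partition_dist (fst c) cs)") auto
next
  case (3 k c cs x lo hi)
  then show ?case
    using length_partition_dist[of "fst c" cs] by (cases "result (partition_dist (fst c) cs)") auto
qed

definition keep_closest :: "nat \<Rightarrow> ('d::finite) knn_buffer \<Rightarrow> 'd knn_buffer comp" where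
  "keep_closest k buf = ticks 1 \<triangleright> (\<lambda>_.
     if length buf \<le> k then ret buf else select_closest k buf)"

definition buffer_insert ::
    "nat \<Rightarrow> real ^ 'd \<Rightarrow> ('d::finite) knn_buffer \<Rightarrow> real ^ 'd \<Rightarrow> 'd knn_buffer comp" where
  "buffer_insert k q buf p = point_dist q p \<triangleright> (\<lambda>\<delta>. ticks 2 \<triangleright> (\<lambda>_.
     let buf' = buf @ [(\<delta>, p)] in
     if length buf' < 2 * k then ret buf' else keep_closest k buf'))"

text \<open>
  The pruning test succeeds if \<open>k\<close> candidates are known and the box is no closer than the \<open>k\<close>-th
  closest of them. The buffer is returned along with the answer since it may have been reduced to
  its \<open>k\<close> closest candidates.
\<close>

definition can_prune ::
    "nat \<Rightarrow> real ^ 'd \<Rightarrow> real ^ 'd \<Rightarrow> real ^ 'd \<Rightarrow> ('d::finite) knn_buffer \<Rightarrow>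
       (bool \<times> 'd knn_buffer) comp" where
  "can_prune k q lo hi buf = ticks 1 \<triangleright> (\<lambda>_.
     if length buf < k then ret (False, buf)
     else keep_closest k buf \<triangleright> (\<lambda>buf'.
       seq_fold (\<lambda>r c. ticks 1 \<triangleright> (\<lambda>_. ret (max r (fst c)))) 0 buf' \<triangleright> (\<lambda>r.
       box_dist q lo hi \<triangleright> (\<lambda>\<delta>. ticks 1 \<triangleright> (\<lambda>_. ret (r \<le> \<delta>, buf'))))))"


subsection \<open>Batch queries\<close>

primrec traverse ::
    "nat \<Rightarrow> real ^ 'd \<Rightarrow> ('d::finite) kd_tree \<Rightarrow> 'd knn_buffer \<Rightarrow> 'd knn_buffer comp" where
  "traverse k q (Leaf lo hi ps) buf = ticks 1 \<triangleright> (\<lambda>_.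
     can_prune k q lo hi buf \<triangleright> (\<lambda>(pruned, buf').
     if pruned then ret buf' else seq_fold (buffer_insert k q) buf' ps))"
| "traverse k q (Node lo hi i s l r) buf = ticks 1 \<triangleright> (\<lambda>_.
     can_prune k q lo hi buf \<triangleright> (\<lambda>(pruned, buf').
     if pruned then ret buf'
     else ticks 1 \<triangleright> (\<lambda>_.
       if q $ i \<le> s then traverse k q l buf' \<triangleright> traverse k q r
       else traverse k q r buf' \<triangleright> traverse k q l)))"

definition alloc_buffer :: "nat \<Rightarrow> ('d::finite) knn_buffer comp" where
  "alloc_buffer k = ticks (2 * k) \<triangleright> (\<lambda>_. ret [])"

definition extract_points :: "nat \<Rightarrow> ('d::finite) knn_buffer \<Rightarrow> (real ^ 'd) list comp" where
  "extract_points k buf = keep_closest k buf \<triangleright> (\<lambda>buf'.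
     ticks (1 + length buf') \<triangleright> (\<lambda>_. ret (map snd buf')))"

definition batch_knn ::
    "nat \<Rightarrow> ('d::finite) bdl_tree \<Rightarrow> (real ^ 'd) list \<Rightarrow> (real ^ 'd) list list comp" where
  "batch_knn k T qs =
     par_map (\<lambda>_. alloc_buffer k) qs \<triangleright> (\<lambda>bufs.
     seq_fold (\<lambda>bufs t. par_map (\<lambda>(q, buf). traverse k q t buf) (zip qs bufs))
       bufs (nonempty_trees T) \<triangleright> (\<lambda>bufs.
     par_map (extract_points k) bufs))"

end

theory Submission
  imports Defs
begin

text \<open>
  A buffer \<open>M\<close> may replace the multiset \<open>S\<close> of points seen so far if \<open>M\<close> is contained in \<open>S\<close> and, for
  every radius \<open>r\<close>, both contain the same number of points at distance at most \<open>r\<close>, counted up to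
  \<open>k\<close>. This relation is transitive and compatible with adding points, and it survives both the
  selection of the \<open>k\<close> closest candidates and the pruning of a box; for buffers of at most \<open>k\<close> points
  it says that they are the \<open>k\<close> nearest neighbors.
  For the cost, a pruning test and an insertion are constant-time as the buffer has fewer
  than \<open>2 * k\<close> entries. Since no leaf and no tree is empty, at most \<open>2 * n - 1\<close> tree nodes are visited
  in at most \<open>n\<close> rounds.
\<close>

section \<open>Additivity of costs and bounds for parallel loops\<close>

section \<open>Work and depth\<close>

lemma result_ret [simp]: "result (ret x) = x"
  and work_ret [simp]: "work (ret x) = 0"
  and depth_ret [simp]: "depth (ret x) = 0"
  by (simp_all add: ret_def)

lemma work_ticks [simp]: "work (ticks c) = c"
  and depth_ticks [simp]: "depth (ticks c) = c"
  by (simp_all add: ticks_def)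

lemma result_seq [simp]: "result (m \<triangleright> f) = result (f (result m))"
  and work_seq [simp]: "work (m \<triangleright> f) = work m + work (f (result m))"
  and depth_seq [simp]: "depth (m \<triangleright> f) = depth m + depth (f (result m))"
  by (simp_all add: seq_def Let_def)

lemma result_par_map [simp]: "result (par_map f xs) = map (\<lambda>x. result (f x)) xs"
  by (simp add: par_map_def)

lemma work_par_map_le:
  assumes "\<And>x. x \<in> set xs \<Longrightarrow> work (f x) \<le> w"
  shows "work (par_map f xs) \<le> 1 + length xs * (1 + w)"
proof -
  have "(\<Sum>x\<leftarrow>xs. 1 + work (f x)) \<le> (\<Sum>x\<leftarrow>xs. 1 + w)"
    using assms by (intro sum_list_mono) simp
  also have "\<dots> = length xs * (1 + w)"
    by (simp only: sum_list_triv of_nat_id)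
  finally show ?thesis
    by (simp add: par_map_def)
qed

lemma depth_par_map_le:
  assumes "\<And>x. x \<in> set xs \<Longrightarrow> depth (f x) \<le> w"
  shows "depth (par_map f xs) \<le> 1 + w"
  using assms by (auto simp: par_map_def)

text \<open>Without a parallel loop inside, both costs are sums of the same ticks. Hence one work
  bound for a single query also serves as its depth bound.\<close>

lemma depth_eq_work_seq_fold:
  assumes "\<And>s x. depth (f s x) = work (f s x)"
  shows "depth (seq_fold f s xs) = work (seq_fold f s xs)"
  by (induction xs arbitrary: s) (simp_all add: assms)

lemma depth_partition_dist: "depth (partition_dist r cs) = work (partition_dist r cs)"
  by (induction cs) (auto split: prod.splits)

lemma depth_select_closest: "depth (select_closest k cs) = work (select_closest k cs)"
  by (induction k cs rule: select_closest.induct)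
     (auto simp: depth_partition_dist split: prod.splits)

lemma depth_keep_closest: "depth (keep_closest k buf) = work (keep_closest k buf)"
  by (simp add: keep_closest_def depth_select_closest)

lemma depth_buffer_insert: "depth (buffer_insert k q buf p) = work (buffer_insert k q buf p)"
  by (simp add: buffer_insert_def point_dist_def Let_def depth_keep_closest)

lemma depth_can_prune: "depth (can_prune k q lo hi buf) = work (can_prune k q lo hi buf)"
  by (simp add: can_prune_def depth_keep_closest depth_eq_work_seq_fold box_dist_def)

lemma depth_traverse: "depth (traverse k q t buf) = work (traverse k q t buf)"
  by (induction t arbitrary: buf)
     (auto simp: depth_can_prune depth_eq_work_seq_fold depth_buffer_insert split: prod.splits)

lemma depth_extract_points: "depth (extract_points k buf) = work (extract_points k buf)"
  by (simp add: extract_points_def depth_keep_closest)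


section \<open>A truncated counting preorder on multisets and its link to nearest neighbors\<close>

section \<open>Retaining the smallest elements\<close>

text \<open>The key \<open>f\<close> stays abstract since it is \<open>fst\<close> on buffer entries
  and \<open>dist q\<close> on points.\<close>

definition count_le :: "('a \<Rightarrow> real) \<Rightarrow> real \<Rightarrow> 'a multiset \<Rightarrow> nat" where
  "count_le f r M = size {#x \<in># M. f x \<le> r#}"

definition retains :: "nat \<Rightarrow> ('a \<Rightarrow> real) \<Rightarrow> 'a multiset \<Rightarrow> 'a multiset \<Rightarrow> bool" where
  "retains k f M S \<longleftrightarrow> M \<subseteq># S \<and> (\<forall>r. min k (count_le f r M) = min k (count_le f r S))"

lemma count_le_union [simp]: "count_le f r (M + N) = count_le f r M + count_le f r N"
  by (simp add: count_le_def)

lemma count_le_add_mset [simp]: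
  "count_le f r (add_mset x M) = (if f x \<le> r then Suc (count_le f r M) else count_le f r M)"
  by (simp add: count_le_def)

lemma count_le_all: "(\<And>x. x \<in># M \<Longrightarrow> f x \<le> r) \<Longrightarrow> count_le f r M = size M"
  unfolding count_le_def by (metis filter_mset_True filter_mset_cong)

lemma count_le_none: "(\<And>x. x \<in># M \<Longrightarrow> r < f x) \<Longrightarrow> count_le f r M = 0"
  by (auto simp: count_le_def filter_mset_eq_conv not_le)

lemma count_le_size: "count_le f r M \<le> size M"
  by (simp add: count_le_def size_mset_mono)

lemma count_le_image_mset: "count_le f r (image_mset g M) = count_le (f \<circ> g) r M"
  by (simp add: count_le_def filter_mset_image_mset)

lemma retains_refl: "retains k f M M"
  by (simp add: retains_def)

lemma retains_trans: "retains k f M N \<Longrightarrow> retains k f N S \<Longrightarrow> retains k f M S"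
  by (auto simp: retains_def intro: subset_mset.order_trans)

text \<open>\<open>min k (a + c)\<close> depends on \<open>a\<close> only through
  \<open>min k a\<close>.\<close>

lemma retains_union: "retains k f M S \<Longrightarrow> retains k f (M + N) (S + N)"
proof -
  assume a: "retains k f M S"
  have "min k (count_le f r M + count_le f r N) = min k (count_le f r S + count_le f r N)" for r
  proof -
    have "min k (count_le f r M) = min k (count_le f r S)"
      using a by (simp add: retains_def)
    then show ?thesis by linarith
  qed
  then show ?thesis
    using a by (simp add: retains_def)
qed

text \<open>From radius \<open>R\<close> on, \<open>M\<close> alone already reaches the cap
  \<open>k\<close>; below \<open>R\<close>, nothing of \<open>N\<close> is counted. Selection and
  pruning both reduce to this.\<close>

lemma retains_discard:
  assumes "k \<le> size M" "\<And>x. x \<in># M \<Longrightarrow> f x \<le> R" "\<And>x. x \<in># N \<Longrightarrow> R \<le> f x"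
  shows "retains k f M (M + N)"
proof -
  have "min k (count_le f r M) = min k (count_le f r M + count_le f r N)" for r
  proof (cases "R \<le> r")
    case True
    then have "count_le f r M = size M"
      using assms(2) by (intro count_le_all) force
    then show ?thesis using assms(1) by simp
  next
    case False
    then have "count_le f r N = 0"
      using assms(3) by (intro count_le_none) force
    then show ?thesis by simp
  qed
  then show ?thesis by (simp add: retains_def)
qed

text \<open>Carries facts about entries keyed by \<open>fst\<close> over to the underlying points
  keyed by their distance.\<close>

lemma retains_image_mset:
  assumes "retains k f M S" "\<And>x. x \<in># S \<Longrightarrow> f x = h (g x)"
  shows "retains k h (image_mset g M) (image_mset g S)"
proof -
  have sub: "M \<subseteq># S"
    using assms(1) by (simp add: retains_def)
  have "count_le h r (image_mset g N) = count_le f r N" if "N \<subseteq># S" for r N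
  proof -
    have "{#x \<in># N. h (g x) \<le> r#} = {#x \<in># N. f x \<le> r#}"
      using assms(2) that by (intro filter_mset_cong) (auto dest: mset_subset_eqD)
    then show ?thesis
      unfolding count_le_image_mset by (simp add: count_le_def)
  qed
  then show ?thesis
    using assms(1) sub by (simp add: retains_def image_mset_subseteq_mono)
qed

text \<open>A radius enclosing all of \<open>S\<close> gives the length. If an omitted
  \<open>z\<close> were closer than a kept \<open>y\<close>, the counts at radius
  \<open>dist q z\<close> would differ below the cap.\<close>

lemma is_knn_if_retains:
  assumes "retains k (dist q) (mset ys) S" "length ys \<le> k"
  shows "is_knn k S q ys"
  unfolding is_knn_def
proof (intro conjI ballI)
  show sub: "mset ys \<subseteq># S"
    using assms(1) by (simp add: retains_def)
  have eq: "min k (count_le (dist q) r (mset ys)) = min k (count_le (dist q) r S)" for r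
    using assms(1) by (simp add: retains_def)
  \<comment> \<open>For empty \<open>S\<close> this value is unspecified, but the bound by
    \<open>R\<close> is then vacuous.\<close>
  define R where "R = Max (dist q ` set_mset S)"
  have R: "dist q x \<le> R" if "x \<in># S" for x
    using that by (simp add: R_def)
  have "count_le (dist q) R S = size S"
    using R by (rule count_le_all)
  moreover have "count_le (dist q) R (mset ys) = size (mset ys)"
    using R sub by (intro count_le_all) (blast dest: mset_subset_eqD)
  ultimately show "length ys = min k (size S)"
    using eq[of R] assms(2) by simp
  fix y z assume y: "y \<in> set ys" and z: "z \<in># S - mset ys"
  show "dist q y \<le> dist q z"
  proof (rule ccontr)
    assume "\<not> dist q y \<le> dist q z"
    \<comment> \<open>Since \<open>y\<close> lies outside the radius \<open>dist q z\<close>, fewer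
      than \<open>k\<close> elements of \<open>ys\<close> are counted, so the cap \<open>k\<close>
      is not active there.\<close>
    moreover have "add_mset y (mset ys - {#y#}) = mset ys"
      using y by simp
    then have "count_le (dist q) (dist q z) (mset ys) =
        count_le (dist q) (dist q z) (add_mset y (mset ys - {#y#}))" by simp
    ultimately have "count_le (dist q) (dist q z) (mset ys) \<le> size (mset ys - {#y#})"
      by (simp add: count_le_size)
    also have "\<dots> < length ys"
      using y by (metis size_Diff1_less set_mset_mset size_mset)
    finally have less: "count_le (dist q) (dist q z) (mset ys) < k"
      using assms(2) by simp
    \<comment> \<open>Splitting off \<open>z\<close> shows that \<open>S\<close> counts at least one
      point more than \<open>ys\<close>.\<close>
    have "S = mset ys + add_mset z (S - mset ys - {#z#})"
      using sub z by (metis insert_DiffM subset_mset.add_diff_inverse)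
    then have "count_le (dist q) (dist q z) S =
        count_le (dist q) (dist q z) (mset ys + add_mset z (S - mset ys - {#z#}))"
      by simp
    then show False
      using eq[of "dist q z"] less by simp
  qed
qed


section \<open>Correctness and quadratic cost of quickselect\<close>

section \<open>Selection\<close>

lemma result_partition_dist:
  "result (partition_dist r cs) = (filter (\<lambda>c. fst c < r) cs, filter (\<lambda>c. \<not> fst c < r) cs)"
  by (induction cs) simp_all

lemma work_partition_dist: "work (partition_dist r cs) = length cs"
  by (induction cs) (auto split: prod.splits)

lemma length_select_closest: "length (result (select_closest k cs)) = min k (length cs)"
proof (induction k cs rule: select_closest.induct)
  case (2 k c cs)
  then show ?case
    using sum_length_filter_compl[of "\<lambda>c'. fst c' < fst c" cs]
    by (auto simp: result_partition_dist)
qed simp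

text \<open>With \<open>m\<close> elements besides the pivot, one round costs at most
  \<open>2 * m + 1\<close>, which the increment \<open>2 * m + 3\<close> between consecutive squares
  covers.\<close>

lemma work_select_closest: "work (select_closest k cs) \<le> (1 + length cs)\<^sup>2"
proof (induction k cs rule: select_closest.induct)
  case (2 k c cs)
  let ?lo = "filter (\<lambda>c'. fst c' < fst c) cs" and ?hi = "filter (\<lambda>c'. \<not> fst c' < fst c) cs"
  let ?w = "if k \<le> length ?lo then work (select_closest k ?lo)
            else work (select_closest (k - length ?lo - 1) ?hi)"
  have "?w \<le> (1 + length cs)\<^sup>2"
  proof (cases "k \<le> length ?lo")
    case True
    then have "?w \<le> (1 + length ?lo)\<^sup>2"
      using 2(1) by (simp add: result_partition_dist)
    also have "\<dots> \<le> (1 + length cs)\<^sup>2" by (simp add: power_mono)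
    finally show ?thesis .
  next
    case False
    then have "?w \<le> (1 + length ?hi)\<^sup>2"
      using 2(2) by (simp add: result_partition_dist)
    also have "\<dots> \<le> (1 + length cs)\<^sup>2" by (simp add: power_mono)
    finally show ?thesis .
  qed
  moreover have "work (select_closest k (c # cs)) = length cs + 1 + length ?lo + ?w"
    by (simp add: result_partition_dist work_partition_dist)
  moreover have "length ?lo \<le> length cs" by simp
  moreover have "(1 + length (c # cs))\<^sup>2 = (1 + length cs)\<^sup>2 + 2 * length cs + 3"
    by (simp add: power2_eq_square)
  ultimately show ?case by linarith
qed simp

lemma retains_select_closest: "retains k fst (mset (result (select_closest k cs))) (mset cs)"
proof (induction k cs rule: select_closest.induct)
  case (1 k)
  show ?case by (simp add: retains_refl)
next
  case (2 k c cs)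
  let ?lo = "filter (\<lambda>c'. fst c' < fst c) cs" and ?hi = "filter (\<lambda>c'. \<not> fst c' < fst c) cs"
  have cs: "mset (c # cs) = mset ?lo + add_mset c (mset ?hi)"
    by (simp add: multiset_partition[symmetric])
  show ?case
  proof (cases "k \<le> length ?lo")
    case True
    have "retains k fst (mset (result (select_closest k ?lo))) (mset ?lo)"
      using 2(1) True by (simp add: result_partition_dist)
    \<comment> \<open>The pivot's distance is the threshold separating the lower part from
      everything thrown away.\<close>
    moreover have "retains k fst (mset ?lo) (mset ?lo + add_mset c (mset ?hi))"
      using True by (intro retains_discard[where R = "fst c"]) (auto simp del: mset_filter)
    ultimately have "retains k fst (mset (result (select_closest k ?lo))) (mset (c # cs))"
      unfolding cs by (rule retains_trans)
    then show ?thesis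
      using True by (simp add: result_partition_dist)
  next
    case False
    define ys where "ys = result (select_closest (k - length ?lo - 1) ?hi)"
    have IH: "retains (k - length ?lo - 1) fst (mset ys) (mset ?hi)"
      using 2(2) False by (simp add: result_partition_dist ys_def)
    have "min k (count_le fst r (mset ?lo + add_mset c (mset ys))) =
        min k (count_le fst r (mset ?lo + add_mset c (mset ?hi)))" for r
    \<comment> \<open>If the radius reaches the pivot, the lower part and the pivot use
      \<open>length ?lo + 1\<close> of the \<open>k\<close> places, leaving just the number
      requested recursively. Otherwise no element of the upper part is counted.\<close>
    proof (cases "fst c \<le> r")
      case True
      then have "count_le fst r (mset ?lo) = length ?lo"
        by (subst count_le_all) (auto simp del: mset_filter)
      moreover have "min (k - length ?lo - 1) (count_le fst r (mset ys)) =
          min (k - length ?lo - 1) (count_le fst r (mset ?hi))"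
        using IH by (simp add: retains_def)
      ultimately show ?thesis
        using True unfolding count_le_union count_le_add_mset if_P[OF True] by linarith
    next
      case r: False
      then have "count_le fst r (mset ?hi) = 0"
        by (intro count_le_none) auto
      moreover have "mset ys \<subseteq># mset ?hi"
        using IH by (simp add: retains_def)
      then have "count_le fst r (mset ys) = 0"
        using r by (intro count_le_none) (fastforce dest: mset_subset_eqD)
      ultimately show ?thesis using r by (simp del: mset_filter)
    qed
    moreover have "mset ?lo + add_mset c (mset ys) \<subseteq># mset ?lo + add_mset c (mset ?hi)"
      using IH by (simp add: retains_def del: mset_filter)
    ultimately have "retains k fst (mset ?lo + add_mset c (mset ys)) (mset (c # cs))"
      unfolding cs retains_def by blast
    then show ?thesis
      using False by (simp add: result_partition_dist ys_def)
  qed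
qed

lemma length_keep_closest: "length (result (keep_closest k buf)) = min k (length buf)"
  by (simp add: keep_closest_def length_select_closest)

lemma retains_keep_closest: "retains k fst (mset (result (keep_closest k buf))) (mset buf)"
  by (simp add: keep_closest_def retains_select_closest retains_refl)

lemma work_keep_closest:
  assumes "length buf \<le> m"
  shows "work (keep_closest k buf) \<le> 1 + (1 + m)\<^sup>2"
proof -
  have "work (keep_closest k buf) \<le> 1 + (1 + length buf)\<^sup>2"
    using work_select_closest[of k buf] by (simp add: keep_closest_def)
  also have "\<dots> \<le> 1 + (1 + m)\<^sup>2"
    using assms by (simp add: power_mono)
  finally show ?thesis .
qed


section \<open>Insertion and pruning: preservation of the candidates at constant cost\<close>

section \<open>The buffer invariant\<close>

text \<open>The bound \<open>length buf < 2 * k\<close> is kept out of the invariant because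
  appending may fill the buffer before the selection shrinks it.\<close>

definition knn_inv ::
    "nat \<Rightarrow> real ^ 'd \<Rightarrow> (real ^ 'd) multiset \<Rightarrow> ('d::finite) knn_buffer \<Rightarrow> bool" where
  "knn_inv k q S buf \<longleftrightarrow>
     (\<forall>c\<in>set buf. fst c = dist q (snd c)) \<and>
     retains k (dist q) (mset (map snd buf)) S"

lemma knn_inv_empty: "knn_inv k q {#} []"
  by (simp add: knn_inv_def retains_refl)

lemma knn_inv_append:
  "knn_inv k q S buf \<Longrightarrow> knn_inv k q (add_mset p S) (buf @ [(dist q p, p)])"
  using retains_union[of k "dist q" "mset (map snd buf)" S "{#p#}"]
  by (auto simp: knn_inv_def)

lemma knn_inv_keep_closest:
  assumes "knn_inv k q S buf"
  shows "knn_inv k q S (result (keep_closest k buf))"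
proof -
  have "mset (result (keep_closest k buf)) \<subseteq># mset buf"
    using retains_keep_closest[of k buf] by (simp add: retains_def)
  then have "set (result (keep_closest k buf)) \<subseteq> set buf"
    by (metis set_mset_mono set_mset_mset)
  moreover have "retains k (dist q) (mset (map snd (result (keep_closest k buf)))) (mset (map snd buf))"
    unfolding mset_map
    using assms by (intro retains_image_mset[OF retains_keep_closest]) (auto simp: knn_inv_def)
  ultimately show ?thesis
    using assms by (auto simp: knn_inv_def intro: retains_trans)
qed

lemma buffer_insert_correct:
  assumes "knn_inv k q S buf" "length buf < 2 * k"
  shows "knn_inv k q (add_mset p S) (result (buffer_insert k q buf p)) \<and>
    length (result (buffer_insert k q buf p)) < 2 * k"
  using assms(2) knn_inv_append[OF assms(1), of p]
    knn_inv_keep_closest[OF knn_inv_append[OF assms(1), of p]]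
  by (auto simp: buffer_insert_def point_dist_def Let_def length_keep_closest)

lemma work_buffer_insert:
  fixes q p :: "real ^ ('d::finite)"
  assumes "length buf < 2 * k"
  shows "work (buffer_insert k q buf p) \<le> CARD('d) + 3 + (1 + 2 * k)\<^sup>2"
  using work_keep_closest[of "buf @ [(dist q p, p)]" "2 * k" k] assms
  by (auto simp: buffer_insert_def point_dist_def Let_def)

text \<open>Every insertion is charged as if it triggered a selection, a constant for fixed
  \<open>k\<close>; \<open>4\<close> is the \<open>3\<close> of one insertion plus the loop's own
  tick.\<close>

lemma buffer_insert_list:
  fixes q :: "real ^ ('d::finite)"
  assumes "knn_inv k q S buf" "length buf < 2 * k"
  shows "knn_inv k q (S + mset ps) (result (seq_fold (buffer_insert k q) buf ps)) \<and>
    length (result (seq_fold (buffer_insert k q) buf ps)) < 2 * k \<and>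
    work (seq_fold (buffer_insert k q) buf ps) \<le> length ps * (CARD('d) + 4 + (1 + 2 * k)\<^sup>2)"
  using assms
proof (induction ps arbitrary: S buf)
  case (Cons p ps)
  let ?buf = "result (buffer_insert k q buf p)"
  have "knn_inv k q (add_mset p S) ?buf" "length ?buf < 2 * k"
    using buffer_insert_correct Cons.prems by blast+
  from Cons.IH[OF this] work_buffer_insert[OF Cons.prems(2), of q p]
  show ?case by simp
qed simp

text \<open>In each coordinate the clamped value lies between those of \<open>q\<close> and
  \<open>x\<close>, so clamping gives a lower bound for the distance to any point of the
  box.\<close>

lemma dist_clamp_le:
  fixes q x lo hi :: "real ^ ('d::finite)"
  assumes "x \<in> cbox lo hi"
  shows "dist q (\<chi> i. max (lo $ i) (min (q $ i) (hi $ i))) \<le> dist q x"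
  unfolding dist_norm
proof (rule norm_le_componentwise_cart)
  fix i
  have "lo $ i \<le> x $ i" "x $ i \<le> hi $ i"
    using assms by (auto simp: mem_box_cart)
  then show "norm ((q - (\<chi> i. max (lo $ i) (min (q $ i) (hi $ i)))) $ i) \<le> norm ((q - x) $ i)"
    by (auto simp: max_def min_def)
qed

lemma result_max_dist_ge:
  fixes buf :: "('d::finite) knn_buffer"
  defines "g \<equiv> \<lambda>r (c :: real \<times> (real ^ 'd)). ticks 1 \<triangleright> (\<lambda>_. ret (max r (fst c)))"
  shows "s \<le> result (seq_fold g s buf) \<and> (\<forall>c\<in>set buf. fst c \<le> result (seq_fold g s buf))"
proof (induction buf arbitrary: s)
  case (Cons c buf)
  show ?case
    using Cons[of "max s (fst c)"] by (simp add: g_def)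
qed simp

lemma work_max_dist:
  "work (seq_fold (\<lambda>r c. ticks 1 \<triangleright> (\<lambda>_. ret (max r (fst c)))) s buf) = 2 * length buf"
  by (induction buf arbitrary: s) simp_all

text \<open>\<open>P\<close> stands for the points of the subtree about to be skipped; a successful
  test lets them count as seen with the buffer returned.\<close>

lemma can_prune_correct:
  assumes "knn_inv k q S buf" "length buf < 2 * k"
    and "result (can_prune k q lo hi buf) = (pruned, buf')"
  shows "knn_inv k q S buf'" "length buf' < 2 * k"
    and "pruned \<Longrightarrow> set_mset P \<subseteq> cbox lo hi \<Longrightarrow> knn_inv k q (S + P) buf'"
proof -
  have cases: "(length buf < k \<and> \<not> pruned \<and> buf' = buf) \<or>
      (k \<le> length buf \<and> buf' = result (keep_closest k buf))"
    using assms(3) by (auto simp: can_prune_def split: if_splits)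
  then show inv: "knn_inv k q S buf'" and "length buf' < 2 * k"
    using assms(1,2) by (auto simp: length_keep_closest intro: knn_inv_keep_closest)
  assume pruned and P: "set_mset P \<subseteq> cbox lo hi"
  define \<delta> where "\<delta> = dist q (\<chi> i. max (lo $ i) (min (q $ i) (hi $ i)))"
  define R where "R = result (seq_fold (\<lambda>r c. ticks 1 \<triangleright> (\<lambda>_. ret (max r (fst c)))) 0 buf')"
  have k: "k \<le> length buf'" and "R \<le> \<delta>"
    using cases assms(3) \<open>pruned\<close>
    by (auto simp: can_prune_def box_dist_def length_keep_closest R_def \<delta>_def split: if_splits)
  \<comment> \<open>The box distance \<open>\<delta>\<close> is the threshold: candidates lie within
    it, the points of \<open>P\<close> at or beyond it. Adding \<open>P\<close> to both sides of the
    invariant then allows transitivity.\<close>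
  have "retains k (dist q) (mset (map snd buf')) (mset (map snd buf') + P)"
  proof (rule retains_discard)
    show "dist q x \<le> \<delta>" if "x \<in># mset (map snd buf')" for x
      using that \<open>R \<le> \<delta>\<close> inv result_max_dist_ge[of 0 buf'] unfolding knn_inv_def R_def by fastforce
    show "\<delta> \<le> dist q x" if "x \<in># P" for x
      using that P unfolding \<delta>_def by (intro dist_clamp_le) auto
  qed (use k in simp)
  moreover have "retains k (dist q) (mset (map snd buf') + P) (S + P)"
    using inv by (intro retains_union) (simp add: knn_inv_def)
  ultimately show "knn_inv k q (S + P) buf'"
    using inv by (auto simp: knn_inv_def intro: retains_trans)
qed

text \<open>The summand \<open>2 * k\<close> pays for scanning at most \<open>k\<close> retained
  entries at two ticks each.\<close>

lemma work_can_prune: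
  fixes q :: "real ^ ('d::finite)"
  assumes "length buf < 2 * k"
  shows "work (can_prune k q lo hi buf) \<le> CARD('d) + 3 + 2 * k + (1 + 2 * k)\<^sup>2"
  using work_keep_closest[of buf "2 * k" k] assms
  by (auto simp: can_prune_def work_max_dist[simplified] box_dist_def length_keep_closest)


section \<open>From one tree to the batch: points pay for nodes and rounds\<close>

section \<open>Queries\<close>

lemma wf_kd_tree_size_pos: "wf_kd_tree t \<Longrightarrow> 1 \<le> size (points t)"
  by (induction t) (auto simp: Suc_le_eq)

text \<open>The pruning test plus two ticks: entering the node and comparing with the splitting
  value.\<close>

definition visit_cost :: "nat \<Rightarrow> nat \<Rightarrow> nat" where
  "visit_cost d k = d + 5 + 2 * k + (1 + 2 * k)\<^sup>2"

text \<open>Each point pays for two node visits and its own insertion.\<close>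

definition point_cost :: "nat \<Rightarrow> nat \<Rightarrow> nat" where
  "point_cost d k = 2 * visit_cost d k + d + 4 + (1 + 2 * k)\<^sup>2"

text \<open>
  The summand \<^term>\<open>visit_cost d k\<close> on the left of the work bound reflects that a tree with \<open>m\<close>
  leaves has \<open>2 * m - 1\<close> nodes rather than \<open>2 * m\<close>; it makes the induction go through.
\<close>

lemma traverse_correct:
  fixes q :: "real ^ ('d::finite)"
  assumes "wf_kd_tree t" "knn_inv k q S buf" "length buf < 2 * k"
  shows "knn_inv k q (S + points t) (result (traverse k q t buf)) \<and>
    length (result (traverse k q t buf)) < 2 * k \<and>
    work (traverse k q t buf) + visit_cost CARD('d) k \<le> point_cost CARD('d) k * size (points t)"
  using assms
proof (induction t arbitrary: S buf)
  case (Leaf lo hi ps)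
  obtain pruned buf' where res: "result (can_prune k q lo hi buf) = (pruned, buf')"
    by fastforce
  note correct = can_prune_correct[OF Leaf.prems(2,3) res]
  let ?I = "CARD('d) + 4 + (1 + 2 * k)\<^sup>2"
  have visit: "1 + work (can_prune k q lo hi buf) \<le> visit_cost CARD('d) k"
    using work_can_prune[OF Leaf.prems(3), of q lo hi] by (simp add: visit_cost_def)
  have "1 \<le> length ps"
    using Leaf.prems(1) by (simp add: Suc_le_eq)
  then have "2 * visit_cost CARD('d) k \<le> 2 * visit_cost CARD('d) k * length ps"
    by simp
  then have cost: "2 * visit_cost CARD('d) k + length ps * ?I \<le> point_cost CARD('d) k * length ps"
    by (simp add: point_cost_def algebra_simps)
  show ?case
  proof (cases pruned)
    case True
    then show ?thesis
      using correct(2) correct(3)[of "mset ps"] Leaf.prems(1) res visit cost by simp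
  next
    case False
    then show ?thesis
      using buffer_insert_list[OF correct(1,2), of ps] res visit cost by simp
  qed
next
  case (Node lo hi i s l r)
  obtain pruned buf' where res: "result (can_prune k q lo hi buf) = (pruned, buf')"
    by fastforce
  note correct = can_prune_correct[OF Node.prems(2,3) res]
  let ?v = "visit_cost CARD('d) k" and ?p = "point_cost CARD('d) k"
  have visit: "2 + work (can_prune k q lo hi buf) \<le> ?v"
    using work_can_prune[OF Node.prems(3), of q lo hi] by (simp add: visit_cost_def)
  have wf: "wf_kd_tree l" "wf_kd_tree r"
    using Node.prems(1) by simp_all
  show ?case
  proof (cases pruned)
    case True
    \<comment> \<open>A pruned subtree still holds a point, which pays for this visit and for the
      extra summand.\<close>
    have "2 * ?v \<le> ?p * size (points l + points r)"
    proof -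
      have "2 * ?v * 1 \<le> ?p * size (points l + points r)"
        using wf_kd_tree_size_pos[OF wf(1)] by (intro mult_le_mono) (auto simp: point_cost_def)
      then show ?thesis by simp
    qed
    then show ?thesis
      using True correct(2) correct(3)[of "points l + points r"] Node.prems(1) res visit
      by simp
  next
    case False
    \<comment> \<open>Both visiting orders are treated at once. Each child contributes a spare
      \<open>?v\<close>: one pays for this node, the other is passed upwards.\<close>
    have *: "knn_inv k q (S + points (Node lo hi i s l r)) (result (traverse k q b buf1)) \<and>
        length (result (traverse k q b buf1)) < 2 * k \<and>
        2 * ?v + work (traverse k q a buf') + work (traverse k q b buf1)
          \<le> ?p * size (points (Node lo hi i s l r))"
      if ab: "(a, b) = (l, r) \<or> (a, b) = (r, l)" and buf1: "buf1 = result (traverse k q a buf')"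
      for a b buf1
    proof -
      have A: "knn_inv k q (S + points a) buf1" "length buf1 < 2 * k"
        "work (traverse k q a buf') + ?v \<le> ?p * size (points a)"
        using Node.IH(1)[OF wf(1) correct(1,2)] Node.IH(2)[OF wf(2) correct(1,2)] ab buf1 by auto
      have B: "knn_inv k q (S + points a + points b) (result (traverse k q b buf1))"
        "length (result (traverse k q b buf1)) < 2 * k"
        "work (traverse k q b buf1) + ?v \<le> ?p * size (points b)"
        using Node.IH(1)[OF wf(1) A(1,2)] Node.IH(2)[OF wf(2) A(1,2)] ab by auto
      have sum: "points (Node lo hi i s l r) = points a + points b"
        using ab by auto
      show ?thesis
        using A(3) B unfolding sum size_union distrib_left by (simp add: add.assoc)
    qed
    show ?thesis
    proof (cases "q $ i \<le> s")
      case True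
      then show ?thesis
        using *[of l r] False res visit by simp
    next
      case False
      then show ?thesis
        using *[of r l] \<open>\<not> pruned\<close> res visit by simp
    qed
  qed
qed

lemma extract_points_correct:
  assumes "knn_inv k q S buf"
  shows "is_knn k S q (result (extract_points k buf))"
  using knn_inv_keep_closest[OF assms] unfolding knn_inv_def
  by (intro is_knn_if_retains) (simp_all add: extract_points_def length_keep_closest)

lemma work_extract_points:
  assumes "length buf < 2 * k"
  shows "work (extract_points k buf) \<le> 2 + k + (1 + 2 * k)\<^sup>2"
  using work_keep_closest[of buf "2 * k" k] assms
  by (auto simp: extract_points_def length_keep_closest)

text \<open>\<open>S\<close> collects the points of the trees already processed. As every listed
  tree holds a point, the overhead of each round is charged to the points of its tree; the
  \<open>2\<close> covers the tick of the fold and the base cost of the parallel loop.\<close>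

lemma traverse_trees_correct:
  fixes qs :: "(real ^ ('d::finite)) list"
  defines "f \<equiv> (\<lambda>k bufs t. par_map (\<lambda>(q, buf). traverse k q t buf) (zip qs bufs))"
  assumes "\<forall>t\<in>set ts. wf_kd_tree t"
    and "list_all2 (\<lambda>q buf. knn_inv k q S buf \<and> length buf < 2 * k) qs bufs"
  shows "list_all2 (\<lambda>q buf. knn_inv k q (S + (\<Sum>t\<leftarrow>ts. points t)) buf \<and> length buf < 2 * k)
      qs (result (seq_fold (f k) bufs ts))"
    (is ?R)
    and "work (seq_fold (f k) bufs ts)
      \<le> (2 + length qs * (1 + point_cost CARD('d) k)) * size (\<Sum>t\<leftarrow>ts. points t)" (is ?W)
    and "depth (seq_fold (f k) bufs ts)
      \<le> (2 + point_cost CARD('d) k) * size (\<Sum>t\<leftarrow>ts. points t)" (is ?D)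
proof -
  have "?R \<and> ?W \<and> ?D"
    using assms(2,3)
  proof (induction ts arbitrary: S bufs)
    case (Cons t ts)
    let ?p = "point_cost CARD('d) k" and ?m = "size (points t)"
    define bufs' where "bufs' = result (f k bufs t)"
    have wf: "wf_kd_tree t"
      using Cons.prems by simp
    note inv = Cons.prems(2)
    have trav: "knn_inv k q (S + points t) (result (traverse k q t buf))"
        "length (result (traverse k q t buf)) < 2 * k"
        "work (traverse k q t buf) \<le> ?p * ?m"
      if "(q, buf) \<in> set (zip qs bufs)" for q buf
      using traverse_correct[OF wf, of k q S buf] inv that by (auto simp: list_all2_iff)
    have len: "length bufs = length qs"
      using inv by (simp add: list_all2_iff)
    have inv': "list_all2 (\<lambda>q buf. knn_inv k q (S + points t) buf \<and> length buf < 2 * k) qs bufs'"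
      unfolding list_all2_conv_all_nth
    proof (intro conjI allI impI)
      show "length qs = length bufs'"
        using len by (simp add: bufs'_def f_def)
      fix i assume i: "i < length qs"
      then have "(qs ! i, bufs ! i) \<in> set (zip qs bufs)"
        and "bufs' ! i = result (traverse k (qs ! i) t (bufs ! i))"
        using len by (auto simp: in_set_zip bufs'_def f_def)
      then show "knn_inv k (qs ! i) (S + points t) (bufs' ! i)" "length (bufs' ! i) < 2 * k"
        using trav(1,2) by simp_all
    qed
    have m: "1 \<le> ?m"
      using wf by (rule wf_kd_tree_size_pos)
    have "work (f k bufs t) \<le> 1 + length qs * (1 + ?p * ?m)"
      using work_par_map_le[of "zip qs bufs" "\<lambda>(q, buf). traverse k q t buf" "?p * ?m"] trav(3) len
      by (auto simp: f_def)
    moreover have "length qs * (1 + ?p * ?m) \<le> length qs * (?m + ?p * ?m)"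
      using m by (intro mult_le_mono) auto
    moreover have "(2 + length qs * (1 + ?p)) * ?m = 2 * ?m + length qs * (?m + ?p * ?m)"
      by (simp add: algebra_simps)
    ultimately have work: "1 + work (f k bufs t) \<le> (2 + length qs * (1 + ?p)) * ?m"
      using m by linarith
    have "depth (f k bufs t) \<le> 1 + ?p * ?m"
      unfolding f_def by (intro depth_par_map_le) (use trav(3) in \<open>auto simp: depth_traverse\<close>)
    then have depth: "1 + depth (f k bufs t) \<le> (2 + ?p) * ?m"
      using m by (simp add: algebra_simps)
    have "\<forall>t\<in>set ts. wf_kd_tree t"
      using Cons.prems by simp
    from Cons.IH[OF this inv'] work depth show ?case
      by (simp add: bufs'_def[symmetric] add_mult_distrib2 add.assoc)
  qed (simp_all)
  then show ?R ?W ?D by blast+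
qed

lemma batch_knn_correct:
  fixes qs :: "(real ^ ('d::finite)) list"
  assumes "wf_bdl_tree X T" "k \<ge> 1"
  defines "n \<equiv> size (bdl_points T)" and "B \<equiv> length qs"
    and "p \<equiv> point_cost CARD('d) k" and "e \<equiv> 2 + k + (1 + 2 * k)\<^sup>2"
  shows "list_all2 (is_knn k (bdl_points T)) qs (result (batch_knn k T qs))"
    and "work (batch_knn k T qs)
      \<le> 1 + B * (1 + 2 * k) + (2 + B * (1 + p)) * n + (1 + B * (1 + e))"
    and "depth (batch_knn k T qs) \<le> 1 + 2 * k + (2 + p) * n + (1 + e)"
proof -
  define bufs where "bufs = result (par_map (\<lambda>_. alloc_buffer k :: 'd knn_buffer comp) qs)"
  let ?fold = "seq_fold (\<lambda>bufs t. par_map (\<lambda>(q, buf). traverse k q t buf) (zip qs bufs))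
    bufs (nonempty_trees T)"
  have wf: "\<forall>t\<in>set (nonempty_trees T). wf_kd_tree t"
    using assms(1) by (simp add: wf_bdl_tree_def)
  \<comment> \<open>The rounds start from empty buffers with no points seen;
    \<open>k \<ge> 1\<close> gives \<open>0 < 2 * k\<close>.\<close>
  have "list_all2 (\<lambda>q buf. knn_inv k q {#} buf \<and> length buf < 2 * k) qs bufs"
    using assms(2)
    by (auto simp: bufs_def alloc_buffer_def list_all2_conv_all_nth knn_inv_empty)
  note trees = traverse_trees_correct[OF wf this, folded bdl_points_def]
  let ?bufs' = "result ?fold"
  have inv: "list_all2 (\<lambda>q buf. knn_inv k q (bdl_points T) buf \<and> length buf < 2 * k) qs ?bufs'"
    using trees(1) by simp
  have len: "length ?bufs' = B"
    using inv by (simp add: list_all2_iff B_def)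
  have short: "length buf < 2 * k" if "buf \<in> set ?bufs'" for buf
    using inv that by (auto simp: list_all2_conv_all_nth in_set_conv_nth)
  have batch: "batch_knn k T qs = par_map (\<lambda>_. alloc_buffer k) qs \<triangleright> (\<lambda>bufs.
     seq_fold (\<lambda>bufs t. par_map (\<lambda>(q, buf). traverse k q t buf) (zip qs bufs))
       bufs (nonempty_trees T) \<triangleright> par_map (extract_points k))"
    by (simp add: batch_knn_def)
  have alloc: "work (par_map (\<lambda>_. alloc_buffer k :: 'd knn_buffer comp) qs) \<le> 1 + B * (1 + 2 * k)"
    "depth (par_map (\<lambda>_. alloc_buffer k :: 'd knn_buffer comp) qs) \<le> 1 + 2 * k"
    unfolding B_def
    by (intro work_par_map_le depth_par_map_le; simp add: alloc_buffer_def)+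
  have extr: "work (par_map (extract_points k) ?bufs') \<le> 1 + B * (1 + e)"
    "depth (par_map (extract_points k) ?bufs') \<le> 1 + e"
    unfolding len[symmetric] e_def
    by (intro work_par_map_le depth_par_map_le;
        use work_extract_points short in \<open>force simp: depth_extract_points\<close>)+
  show "list_all2 (is_knn k (bdl_points T)) qs (result (batch_knn k T qs))"
  proof -
    have "result (batch_knn k T qs) = map (\<lambda>buf. result (extract_points k buf)) ?bufs'"
      by (simp add: batch bufs_def)
    moreover have "list_all2 (\<lambda>q buf. is_knn k (bdl_points T) q (result (extract_points k buf)))
        qs ?bufs'"
      using inv by (rule list_all2_mono) (simp add: extract_points_correct)
    ultimately show ?thesis
      by (simp add: list_all2_map2)
  qed
  show "work (batch_knn k T qs)
      \<le> 1 + B * (1 + 2 * k) + (2 + B * (1 + p)) * n + (1 + B * (1 + e))"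
    unfolding batch work_seq bufs_def[symmetric]
    using alloc(1) trees(2) extr(1) unfolding B_def n_def p_def by linarith
  show "depth (batch_knn k T qs) \<le> 1 + 2 * k + (2 + p) * n + (1 + e)"
    unfolding batch depth_seq bufs_def[symmetric]
    using alloc(2) trees(3) extr(2) unfolding n_def p_def by linarith
qed

theorem theorem5:
  fixes k X :: nat
  assumes "k \<ge> 1" and "X \<ge> 1"
  shows "\<exists>C::real. \<forall>(T :: ('d::finite) bdl_tree) (qs :: (real ^ 'd) list) (n::nat) (B::nat).
    wf_bdl_tree X T \<longrightarrow> n = size (bdl_points T) \<longrightarrow> B = length qs \<longrightarrow>
      list_all2 (is_knn k (bdl_points T)) qs (result (batch_knn k T qs)) \<and>
      (n \<ge> 1 \<longrightarrow> B \<ge> 1 \<longrightarrow>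
        real (work (batch_knn k T qs)) \<le> C * (real B * real n) \<and>
        real (depth (batch_knn k T qs)) \<le> C * real n)"
proof -
  define p where "p = point_cost CARD('d) k"
  define e where "e = 2 + k + (1 + 2 * k)\<^sup>2"
  \<comment> \<open>\<open>C\<close> splits as \<open>4 + (2 + 2 * k + e) + (1 + p)\<close>:
    \<open>4\<close> absorbs the terms \<open>2\<close> and \<open>2 * n\<close>, the middle part
    allocation and extraction, the last the traversals. It depends only on \<open>k\<close> and the
    dimension.\<close>
  define C where "C = 7 + 2 * k + p + e"
  have work: "work (batch_knn k T qs) \<le> C * (length qs * size (bdl_points T))"
    if "wf_bdl_tree X T" "size (bdl_points T) \<ge> 1" "length qs \<ge> 1"
    for T :: "'d bdl_tree" and qs
  proof -
    let ?n = "size (bdl_points T)" and ?B = "length qs"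
    have "1 * 1 \<le> ?B * ?n"
      using that(2,3) by (intro mult_le_mono)
    moreover have "1 * ?n \<le> ?B * ?n"
      using that(3) by (intro mult_le_mono) simp_all
    moreover have "?B * (2 + 2 * k + e) * 1 \<le> ?B * (2 + 2 * k + e) * ?n"
      using that(2) by (intro mult_le_mono) simp_all
    moreover have "1 + ?B * (1 + 2 * k) + (2 + ?B * (1 + p)) * ?n + (1 + ?B * (1 + e)) =
        2 + ?B * (2 + 2 * k + e) + 2 * ?n + (1 + p) * (?B * ?n)"
      by (simp add: algebra_simps)
    moreover have "C * (?B * ?n) =
        4 * (?B * ?n) + ?B * (2 + 2 * k + e) * ?n + (1 + p) * (?B * ?n)"
      by (simp add: C_def algebra_simps)
    ultimately have "1 + ?B * (1 + 2 * k) + (2 + ?B * (1 + p)) * ?n + (1 + ?B * (1 + e))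
        \<le> C * (?B * ?n)"
      by linarith
    then show ?thesis
      using batch_knn_correct(2)[OF that(1) assms(1), of qs] unfolding p_def e_def by linarith
  qed
  have depth: "depth (batch_knn k T qs) \<le> C * size (bdl_points T)"
    if "wf_bdl_tree X T" "size (bdl_points T) \<ge> 1" for T :: "'d bdl_tree" and qs
  proof -
    let ?n = "size (bdl_points T)"
    have "(2 + 2 * k + e) * 1 \<le> (2 + 2 * k + e) * ?n"
      using that(2) by (intro mult_le_mono) simp_all
    then have "1 + 2 * k + (2 + p) * ?n + (1 + e) \<le> C * ?n"
      by (simp add: C_def algebra_simps)
    then show ?thesis
      using batch_knn_correct(3)[OF that(1) assms(1), of qs] unfolding p_def e_def by linarith
  qed
  show ?thesis
    using batch_knn_correct(1)[OF _ assms(1)] work depth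
    by (intro exI[of _ "real C"]) (auto simp flip: of_nat_mult)
qed

end
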